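(* Let $f:\mathbb{R}^N\to\mathbb{R}^N$ be $C^1$ with equilibrium $x_\ast$, and fix $T>0$. Suppose there exist a real $\lambda_\ast>0$ and $n\in\mathbb{Z}$ with $\lambda_\ast+\frac{2\pi n i}{T}\in\sigma(f'(x_\ast))$. Let $K\in\mathbb{R}^{N\times N}$ satisfy $\sigma(K)\subseteq\mathbb{R}$ and $f'(x_\ast)K=Kf'(x_\ast)$. Then $\det(\lambda I-f'(x_\ast)-K[1-e^{-\lambda T}])=0$ has a root with $\mathrm{Re}\,\lambda>0$; in particular $x_\ast$ is unstable as a solution of $\dot x(t)=f(x(t))+K[x(t)-x(t-T)]$.
   Context: Eigenvalues of the linearized delay equation $\dot y(t)=f'(x_\ast)y(t)+K[y(t)-y(t-T)]$ are the roots of $\lambda\mapsto\det(\lambda I-f'(x_\ast)-K[1-e^{-\lambda T}])$. *)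

theory Defs
  imports "HOL-Analysis.Analysis"
begin

definition cmat :: "real^'n^'n \<Rightarrow> complex^'n^'n" where
  "cmat M = (\<chi> i j. complex_of_real (M $ i $ j))"

definition cspectrum :: "complex^'n^'n \<Rightarrow> complex set" where
  "cspectrum M = {\<mu>. \<exists>v. v \<noteq> 0 \<and> M *v v = \<mu> *s v}"

definition C1_map :: "(real^'n \<Rightarrow> real^'n) \<Rightarrow> bool" where
  "C1_map f \<longleftrightarrow> (\<exists>J :: real^'n \<Rightarrow> real^'n^'n.
      (\<forall>x. (f has_derivative (\<lambda>h. J x *v h)) (at x)) \<and> continuous_on UNIV J)"

end

theory Submission
  imports Defs "HOL-Computational_Algebra.Fundamental_Theorem_Algebra"
begin

text \<open>Since \<open>A\<close> and \<open>K\<close> commute, the eigenspace of \<open>A\<close> for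
  \<open>\<mu> = \<lambda>\<^sub>* + 2\<pi>in/T\<close> is \<open>K\<close>-invariant, so it contains an eigenvector \<open>w\<close> of \<open>K\<close>,
  whose eigenvalue \<open>k\<close> is real. On \<open>w\<close> the characteristic matrix acts as the scalar
  \<open>z - \<mu> - (1 - e\<^sup>-\<^sup>z\<^sup>T) k\<close>. For \<open>z = x + 2\<pi>in/T\<close> the exponential reduces to
  \<open>e\<^sup>-\<^sup>x\<^sup>T\<close> by periodicity, and the real equation \<open>x = \<lambda>\<^sub>* + k (1 - e\<^sup>-\<^sup>x\<^sup>T)\<close>
  has a root \<open>x > 0\<close> by the intermediate value theorem. Only the spectral data of
  \<open>A = f'(x\<^sub>*)\<close> and \<open>K\<close> enter; the hypotheses on \<open>f\<close> merely identify \<open>A\<close>.\<close>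

definition poly_matrix_apply :: "'a::field poly \<Rightarrow> 'a^'n^'n \<Rightarrow> 'a^'n \<Rightarrow> 'a^'n" where
  "poly_matrix_apply p K v = fold_coeffs (\<lambda>a w. a *s v + K *v w) p 0"

lemma poly_matrix_apply_0 [simp]: "poly_matrix_apply 0 K v = 0"
  by (simp add: poly_matrix_apply_def)

lemma poly_matrix_apply_pCons [simp]:
  "poly_matrix_apply (pCons a p) K v = a *s v + K *v poly_matrix_apply p K v"
  by (cases "p = 0 \<and> a = 0") (auto simp: poly_matrix_apply_def)

lemma poly_matrix_apply_add:
  "poly_matrix_apply (p + q) K v = poly_matrix_apply p K v + poly_matrix_apply q K v"
proof (induction p arbitrary: q)
  case (pCons a p)
  then show ?case
    by (cases q) (simp add: vector_sadd_rdistrib matrix_vector_right_distrib algebra_simps)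
qed simp

lemma poly_matrix_apply_smult:
  "poly_matrix_apply (smult c p) K v = c *s poly_matrix_apply p K v"
  by (induction p) (simp_all add: vector_scalar_commute vector_add_ldistrib vector_smult_assoc)

lemma poly_matrix_apply_diff:
  "poly_matrix_apply (p - q) K v = poly_matrix_apply p K v - poly_matrix_apply q K v"
  using poly_matrix_apply_add[of "p - q" q K v] by (simp add: eq_diff_eq)

lemma poly_matrix_apply_mult:
  "poly_matrix_apply (p * q) K v = poly_matrix_apply p K (poly_matrix_apply q K v)"
  by (induction p)
    (simp_all add: mult_pCons_left poly_matrix_apply_add poly_matrix_apply_smult)

lemma poly_matrix_apply_monom:
  "poly_matrix_apply (monom c k) K v = c *s ((*v) K ^^ k) v"
  by (induction k) (simp_all add: monom_0 monom_Suc vector_scalar_commute)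

lemma poly_matrix_apply_sum:
  "poly_matrix_apply (\<Sum>i\<in>I. p i) K v = (\<Sum>i\<in>I. poly_matrix_apply (p i) K v)"
  by (induction I rule: infinite_finite_induct) (simp_all add: poly_matrix_apply_add)

lemma poly_matrix_apply_in_invariant_subspace:
  assumes "vec.subspace S" "\<And>w. w \<in> S \<Longrightarrow> K *v w \<in> S" "v \<in> S"
  shows "poly_matrix_apply p K v \<in> S"
  by (induction p) (simp_all add: assms vec.subspace_add vec.subspace_scale vec.subspace_0)

lemma exists_annihilating_poly:
  fixes K :: "'a::field^'n^'n"
  shows "\<exists>p. p \<noteq> 0 \<and> poly_matrix_apply p K v = 0"
proof -
  define F where "F i = ((*v) K ^^ i) v" for i
  define N where "N = CARD('n)"
  show ?thesis
  proof (cases "inj_on F {..N}")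
    case False
    then obtain i j where ij: "i \<noteq> j" "F i = F j"
      unfolding inj_on_def by auto
    define p where "p = monom (1::'a) i - monom 1 j"
    have "coeff p i = 1"
      using ij by (simp add: p_def coeff_monom)
    moreover have "poly_matrix_apply p K v = 0"
      using ij by (simp add: p_def poly_matrix_apply_diff poly_matrix_apply_monom F_def)
    ultimately show ?thesis
      by (metis coeff_0 zero_neq_one)
  next
    case True
    define S where "S = F ` {..N}"
    have "card S = Suc N"
      using True by (simp add: S_def card_image)
    moreover have "vec.dim S \<le> N"
      using vec.dim_subset[of S UNIV] vec_dim_card[where ?'a='a and ?'n='n] by (simp add: N_def)
    ultimately have "vec.dependent S"
      by (intro vec.dependent_biggerset_general) simp
    then obtain u where u: "\<exists>w\<in>S. u w \<noteq> 0" "(\<Sum>w\<in>S. u w *s w) = 0"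
      using vec.dependent_finite[of S] by (auto simp: S_def)
    define p where "p = (\<Sum>i\<le>N. monom (u (F i)) i)"
    have coeff_p: "coeff p k = u (F k)" if "k \<le> N" for k
      using that by (simp add: p_def coeff_sum coeff_monom)
    from u(1) obtain k where "k \<le> N" "u (F k) \<noteq> 0"
      by (auto simp: S_def)
    then have "p \<noteq> 0"
      using coeff_p by force
    moreover have "poly_matrix_apply p K v = (\<Sum>i\<le>N. u (F i) *s F i)"
      by (simp add: p_def poly_matrix_apply_sum poly_matrix_apply_monom F_def)
    moreover have "(\<Sum>i\<le>N. u (F i) *s F i) = (\<Sum>w\<in>S. u w *s w)"
      unfolding S_def using True by (simp add: sum.reindex)
    ultimately show ?thesis
      using u(2) by auto
  qed
qed

lemma invariant_subspace_has_eigenvector: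
  fixes K :: "complex^'n^'n"
  assumes subspace: "vec.subspace S" and invariant: "\<And>w. w \<in> S \<Longrightarrow> K *v w \<in> S"
    and "v \<in> S" "v \<noteq> 0"
  shows "\<exists>w\<in>S. w \<noteq> 0 \<and> (\<exists>r. K *v w = r *s w)"
proof -
  obtain p where "p \<noteq> 0" "poly_matrix_apply p K v = 0"
    using exists_annihilating_poly by blast
  then show ?thesis
  proof (induction "degree p" arbitrary: p rule: less_induct)
    case less
    show ?case
    proof (cases "degree p = 0")
      case True
      then obtain c where "p = [:c:]" "c \<noteq> 0"
        using less.prems(1) by (metis degree_eq_zeroE pCons_0_0)
      then show ?thesis
        using less.prems(2) \<open>v \<noteq> 0\<close> by simp
    next
      case False
      \<comment> \<open>Split off a linear factor \<open>X - r\<close>: either \<open>q(K) v\<close> is an eigenvector for \<open>r\<close>,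
        or \<open>q\<close> annihilates \<open>v\<close> and has smaller degree.\<close>
      then obtain r where "poly p r = 0"
        using fundamental_theorem_of_algebra[of p] constant_degree[of p] by metis
      then obtain q where p: "p = [:-r, 1:] * q"
        using poly_eq_0_iff_dvd by blast
      have "q \<noteq> 0"
        using less.prems(1) p by auto
      then have "degree q < degree p"
        unfolding p by (subst degree_mult_eq) auto
      define u where "u = poly_matrix_apply q K v"
      have u_in_S: "u \<in> S"
        unfolding u_def using subspace invariant \<open>v \<in> S\<close>
        by (rule poly_matrix_apply_in_invariant_subspace)
      have "K *v u - r *s u = poly_matrix_apply p K v"
        unfolding p poly_matrix_apply_mult u_def by (simp add: algebra_simps)
      then have "K *v u = r *s u"
        using less.prems(2) by simp
      then show ?thesis
        using less.hyps[OF \<open>degree q < degree p\<close> \<open>q \<noteq> 0\<close>] u_in_S unfolding u_def by blast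
    qed
  qed
qed

lemma commuting_matrices_common_eigenvector:
  fixes A K :: "complex^'n^'n"
  assumes commute: "A ** K = K ** A" and "v \<noteq> 0" "A *v v = \<mu> *s v"
  shows "\<exists>w. w \<noteq> 0 \<and> A *v w = \<mu> *s w \<and> (\<exists>r. K *v w = r *s w)"
proof -
  define E where "E = {w. A *v w = \<mu> *s w}"
  have "vec.subspace E"
    by (auto simp: E_def vec.subspace_def matrix_vector_right_distrib vector_add_ldistrib
        vector_scalar_commute)
  moreover have "K *v w \<in> E" if "w \<in> E" for w
  proof -
    have "A *v (K *v w) = K *v (A *v w)"
      by (simp add: matrix_vector_mul_assoc commute)
    then show ?thesis
      using that by (simp add: E_def vector_scalar_commute)
  qed
  ultimately show ?thesis
    using invariant_subspace_has_eigenvector[of E K v] assms(2,3) unfolding E_def by blast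
qed

lemma matrix_vector_mult_mat: "mat c *v x = c *s (x::'a::comm_ring_1^'n)"
proof -
  have "(\<Sum>j\<in>UNIV. (if i = j then c else 0) * x $ j) = c * x $ i" for i
    by (simp add: if_distrib[of "\<lambda>a. a * _"] cong: if_cong)
  then show ?thesis
    by (simp add: vec_eq_iff matrix_vector_mult_def mat_def)
qed

lemma cmat_matrix_mult: "cmat (A ** B) = cmat A ** cmat B"
  by (simp add: cmat_def matrix_matrix_mult_def vec_eq_iff)

lemma det_eq_0_if_common_eigenvector:
  fixes A K :: "'a::field^'n^'n"
  assumes "w \<noteq> 0" "A *v w = \<mu> *s w" "K *v w = r *s w" "z = \<mu> + c * r"
  shows "det (mat z - A - mat c ** K) = 0"
proof -
  have "(mat z - A - mat c ** K) *v w = (z - \<mu> - c * r) *s w"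
    using assms(2,3)
    by (simp add: matrix_vector_mult_diff_rdistrib matrix_vector_mul_assoc[symmetric]
        matrix_vector_mult_mat vec_eq_iff algebra_simps)
  then have "(mat z - A - mat c ** K) *v w = 0"
    using assms(4) by simp
  then show ?thesis
    using assms(1) inj_matrix_vector_mult invertible_det_nz vec.inj_iff_eq_0 by blast
qed

lemma exp_neg_mult_add_period:
  assumes "T \<noteq> 0"
  shows "exp (- (z + 2 * of_real pi * of_int n * \<i> / of_real T) * of_real T) =
    exp (- z * of_real T)"
proof -
  have "- (z + 2 * of_real pi * of_int n * \<i> / of_real T) * of_real T =
      - z * of_real T - of_real (2 * of_int n * pi) * \<i>"
    using assms by (simp add: field_simps)
  moreover have "exp (of_real (2 * of_int n * pi) * \<i>) = 1"
    using exp_integer_2pi[of "of_int n"] by simp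
  ultimately show ?thesis
    by (simp add: exp_diff)
qed

lemma delay_characteristic_eq_positive_root:
  fixes lam0 k T :: real
  assumes "lam0 > 0" "T \<ge> 0"
  shows "\<exists>x>0. x = lam0 + k * (1 - exp (- x * T))"
proof -
  define g where "g x = x - lam0 - k * (1 - exp (- x * T))" for x
  define b where "b = lam0 + \<bar>k\<bar>"
  have "0 \<le> b * T"
    using assms by (simp add: b_def)
  then have "0 \<le> 1 - exp (- b * T)" "1 - exp (- b * T) \<le> 1"
    by auto
  then have "k * (1 - exp (- b * T)) \<le> \<bar>k\<bar>"
    by (meson abs_ge_self abs_ge_zero mult_left_le mult_right_mono order.trans)
  then have "g 0 \<le> 0" "0 \<le> g b" "0 \<le> b"
    using assms by (simp_all add: g_def b_def)
  moreover have "continuous_on {0..b} g"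
    unfolding g_def by (intro continuous_intros)
  ultimately obtain x where "0 \<le> x" "g x = 0"
    using IVT'[of g 0 0 b] by auto
  moreover have "x \<noteq> 0"
    using \<open>g x = 0\<close> assms(1) by (auto simp: g_def)
  ultimately show ?thesis
    unfolding g_def by (intro exI[of _ x]) auto
qed

theorem corollary4:
  fixes f :: "real^'n \<Rightarrow> real^'n"
    and xs :: "real^'n"
    and A K :: "real^'n^'n"
    and T lam0 :: real
    and n :: int
  assumes f_C1: "C1_map f"
    and equil: "f xs = 0"
    and A_deriv: "(f has_derivative (\<lambda>h. A *v h)) (at xs)"
    and T_pos: "T > 0"
    and lam0_pos: "lam0 > 0"
    and eig: "complex_of_real lam0 + 2 * of_real pi * of_int n * \<i> / complex_of_real T
                \<in> cspectrum (cmat A)"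
    and K_real_spec: "\<forall>\<mu> \<in> cspectrum (cmat K). Im \<mu> = 0"
    and commute: "A ** K = K ** A"
  shows "\<exists>z::complex. Re z > 0 \<and>
           det (mat z - cmat A - mat (1 - exp (- z * complex_of_real T)) ** cmat K) = 0"
proof -
  define \<omega> where "\<omega> = 2 * of_real pi * of_int n * \<i> / complex_of_real T"
  obtain v where "v \<noteq> 0" "cmat A *v v = (lam0 + \<omega>) *s v"
    using eig unfolding \<omega>_def cspectrum_def by blast
  moreover have "cmat A ** cmat K = cmat K ** cmat A"
    using commute by (simp flip: cmat_matrix_mult)
  ultimately obtain w r where w: "w \<noteq> 0" "cmat A *v w = (lam0 + \<omega>) *s w" "cmat K *v w = r *s w"
    using commuting_matrices_common_eigenvector by blast
  then have "Im r = 0"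
    using K_real_spec unfolding cspectrum_def by blast
  then obtain k where r: "r = of_real k"
    by (metis complex_is_Real_iff Reals_cases)
  obtain x where "x > 0" and x: "x = lam0 + k * (1 - exp (- x * T))"
    using delay_characteristic_eq_positive_root[OF lam0_pos, of T k] T_pos by auto
  define z where "z = of_real x + \<omega>"
  have "exp (- z * of_real T) = exp (- of_real x * of_real T)"
    using T_pos exp_neg_mult_add_period[of T "of_real x" n] by (simp add: z_def \<omega>_def)
  also have "\<dots> = of_real (exp (- x * T))"
    by (metis exp_of_real of_real_minus of_real_mult)
  finally have exp_z: "exp (- z * of_real T) = of_real (exp (- x * T))" .
  have "complex_of_real x = of_real (lam0 + k * (1 - exp (- x * T)))"
    by (metis x)
  then have "z = (lam0 + \<omega>) + (1 - exp (- z * of_real T)) * r"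
    unfolding exp_z by (simp add: z_def r algebra_simps)
  then have "det (mat z - cmat A - mat (1 - exp (- z * of_real T)) ** cmat K) = 0"
    using det_eq_0_if_common_eigenvector w by blast
  moreover have "Re z > 0"
    using \<open>x > 0\<close> by (simp add: z_def \<omega>_def)
  ultimately show ?thesis
    by blast
qed

end
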